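(* Let $G$ be a finite chordal graph and let $I^*$ be a maximum independent set of $G$. Then every independent set $S$ that can be returned by \textsc{Greedy} on $G$ (for any way of breaking ties) satisfies $|S| \geq \frac{1}{2}|I^*|$.
   Context: All graphs are finite, simple and undirected. For a vertex $v$, $N(v)$ is its set of neighbours, $N[v]=N(v)\cup\{v\}$, $d(v)=|N(v)|$, and $\delta(G)=\min_{v} d(v)$. A graph is chordal if every simple cycle on at least 4 vertices has two non-consecutive vertices that are adjacent. The minimum-degree greedy algorithm \textsc{Greedy} computes an independent set as follows: start with $S=\emptyset$; while the current graph $G$ is nonempty, choose any vertex $v$ with $d(v)=\delta(G)$ (ties among minimum-degree vertices are broken arbitrarily, i.e. adversarially), add $v$ to $S$, and replace $G$ by $G\setminus N[v]$. A solution "can be returned by \textsc{Greedy}" if it is the output for some sequence of tie-breaking choices. *)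

theory Defs
  imports Complex_Main "Graph_Theory.Digraph_Component"
begin

text \<open>
  A finite simple undirected graph is a digraph satisfying \<^locale>\<open>graph\<close>: it is finite, without
  loops and parallel arcs, and its arc relation is symmetric.
\<close>

definition nbhd :: "('a, 'b) pre_digraph \<Rightarrow> 'a \<Rightarrow> 'a set" where
  "nbhd G v = {u \<in> verts G. v \<rightarrow>\<^bsub>G\<^esub> u}"

definition closed_nbhd :: "('a, 'b) pre_digraph \<Rightarrow> 'a \<Rightarrow> 'a set" where
  "closed_nbhd G v = nbhd G v \<union> {v}"

definition vdegree :: "('a, 'b) pre_digraph \<Rightarrow> 'a \<Rightarrow> nat" where
  "vdegree G v = card (nbhd G v)"

definition min_vdegree :: "('a, 'b) pre_digraph \<Rightarrow> nat" where
  "min_vdegree G = Min (vdegree G ` verts G)"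

text \<open>
  A cycle is a list of arcs, so the \<open>i\<close>-th vertex on it is the tail of its \<open>i\<close>-th arc and the number
  of its vertices is its length. \<^const>\<open>pre_digraph.cycle\<close> also admits the closed walks \<open>a, b, a\<close>
  of length 2; the length bound excludes them.
\<close>

definition chordal :: "('a, 'b) pre_digraph \<Rightarrow> bool" where
  "chordal G \<longleftrightarrow>
    (\<forall>p. pre_digraph.cycle G p \<and> 4 \<le> length p \<longrightarrow>
      (\<exists>i j. i < j \<and> j < length p \<and>
        j \<noteq> i + 1 \<and> \<not> (i = 0 \<and> j = length p - 1) \<and>
        tail G (p ! i) \<rightarrow>\<^bsub>G\<^esub> tail G (p ! j)))"

definition indep_set :: "('a, 'b) pre_digraph \<Rightarrow> 'a set \<Rightarrow> bool" where
  "indep_set G S \<longleftrightarrow> S \<subseteq> verts G \<and> (\<forall>u\<in>S. \<forall>v\<in>S. \<not> u \<rightarrow>\<^bsub>G\<^esub> v)"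

definition max_indep_set :: "('a, 'b) pre_digraph \<Rightarrow> 'a set \<Rightarrow> bool" where
  "max_indep_set G I \<longleftrightarrow> indep_set G I \<and> (\<forall>J. indep_set G J \<longrightarrow> card J \<le> card I)"

text \<open>
  One iteration of the greedy loop, acting on the current graph and the set of vertices chosen so
  far. The relation is nondeterministic: it offers every vertex of minimum degree.
\<close>

inductive greedy_step ::
    "('a, 'b) pre_digraph \<times> 'a set \<Rightarrow> ('a, 'b) pre_digraph \<times> 'a set \<Rightarrow> bool" where
  "v \<in> verts G \<Longrightarrow> vdegree G v = min_vdegree G \<Longrightarrow>
    greedy_step (G, S) (G \<restriction> (verts G - closed_nbhd G v), insert v S)"

definition greedy_output :: "('a, 'b) pre_digraph \<Rightarrow> 'a set \<Rightarrow> bool" where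
  "greedy_output G S \<longleftrightarrow> (\<exists>H. greedy_step\<^sup>*\<^sup>* (G, {}) (H, S) \<and> verts H = {})"

end

theory Submission
  imports Defs
begin

text \<open>
  Let \<open>c(G)\<close> be the number of connected components of \<open>G\<close>. By induction along a run of the
  algorithm, \<open>\<alpha>(G) + c(G) \<le> 2|S|\<close>. Suppose that the minimum-degree vertex \<open>v\<close> is chosen, and that an
  independent set \<open>I\<close> meets \<open>N[v]\<close> in \<open>k \<ge> 2\<close> vertices. Each of these has a neighbour outside
  \<open>N[v]\<close>, for otherwise its degree would be smaller than that of \<open>v\<close>. These neighbours lie in \<open>k\<close>
  different components of \<open>G - N[v]\<close>, since a shortest path joining two vertices of \<open>I \<inter> N(v)\<close> through
  one component would close up with \<open>v\<close> to a chordless cycle. So the loss of \<open>k\<close> vertices of \<open>I\<close> is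
  paid for by \<open>k\<close> new components, which replace the single component of \<open>v\<close>.

  The number of components enters only as the size of a set of pairwise unreachable vertices.
\<close>

definition separated :: "('a, 'b) pre_digraph \<Rightarrow> 'a set \<Rightarrow> bool" where
  "separated G A \<longleftrightarrow> A \<subseteq> verts G \<and> (\<forall>a\<in>A. \<forall>b\<in>A. (a, b) \<in> (arcs_ends G)\<^sup>* \<longrightarrow> a = b)"

section \<open>Induced subgraphs\<close>

lemma dominates_induce_subgraph_iff:
  "u \<rightarrow>\<^bsub>G \<restriction> X\<^esub> v \<longleftrightarrow> (u \<rightarrow>\<^bsub>G\<^esub> v) \<and> u \<in> X \<and> v \<in> X"
  by (auto simp: arcs_ends_conv)

lemma graph_induce_subgraph:
  assumes "graph G" "X \<subseteq> verts G"
  shows "graph (G \<restriction> X)"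
proof -
  interpret graph G by fact
  have sym: "symmetric G" by (rule sym_arcs)
  show ?thesis
  proof unfold_locales
    show "finite (verts (G \<restriction> X))"
      using assms(2) by (auto intro: finite_subset)
    show "symmetric (G \<restriction> X)"
      unfolding symmetric_def sym_def
      using arcs_ends_symmetric[OF sym] by (auto simp: dominates_induce_subgraph_iff)
    fix e1 e2 assume "e1 \<in> arcs (G \<restriction> X)" "e2 \<in> arcs (G \<restriction> X)"
      and "arc_to_ends (G \<restriction> X) e1 = arc_to_ends (G \<restriction> X) e2"
    then show "e1 = e2"
      using no_multi_arcs[of e1 e2] by (auto simp: arc_to_ends_def)
  qed (auto dest: no_loops)
qed

text \<open>A cycle of the induced subgraph is a cycle of \<open>G\<close>, and the chord it has
  there joins two vertices of \<open>X\<close>, so the induced subgraph keeps the chord.\<close>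

lemma chordal_induce_subgraph:
  assumes "wf_digraph G" "chordal G" "X \<subseteq> verts G"
  shows "chordal (G \<restriction> X)"
  unfolding chordal_def
proof (intro allI impI)
  interpret wf_digraph G by fact
  fix p assume p: "pre_digraph.cycle (G \<restriction> X) p \<and> 4 \<le> length p"
  have "subgraph (G \<restriction> X) G"
    using induced_induce[OF assms(3)] by auto
  with p have "cycle p" by (metis subgraph_cycle)
  have arcs: "set p \<subseteq> arcs (G \<restriction> X)"
    using p by (auto simp: pre_digraph.cycle_def pre_digraph.awalk_def)
  obtain i j where ij: "i < j" "j < length p" "j \<noteq> i + 1" "\<not> (i = 0 \<and> j = length p - 1)"
    "tail G (p ! i) \<rightarrow>\<^bsub>G\<^esub> tail G (p ! j)"
    using assms(2) \<open>cycle p\<close> p unfolding chordal_def by blast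
  have "p ! i \<in> arcs (G \<restriction> X)" "p ! j \<in> arcs (G \<restriction> X)"
    using ij arcs by (meson less_trans nth_mem subsetD)+
  with ij show "\<exists>i j. i < j \<and> j < length p \<and> j \<noteq> i + 1 \<and> \<not> (i = 0 \<and> j = length p - 1) \<and>
      tail (G \<restriction> X) (p ! i) \<rightarrow>\<^bsub>G \<restriction> X\<^esub> tail (G \<restriction> X) (p ! j)"
    by (intro exI[of _ i] exI[of _ j]) (simp add: dominates_induce_subgraph_iff)
qed

section \<open>Cycles given by their vertices, and chordless cycles\<close>

lemma (in pre_digraph) cas_map_upt:
  assumes "\<And>i. i < n \<Longrightarrow> tail G (a i) = g i \<and> head G (a i) = g (Suc i)"
  shows "cas (g 0) (map a [0..<n]) (g n)"
  using assms
proof (induction n arbitrary: a g)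
  case (Suc n)
  have "cas (g (Suc 0)) (map (\<lambda>i. a (Suc i)) [0..<n]) (g (Suc n))"
    using Suc.prems by (intro Suc.IH[of "\<lambda>i. a (Suc i)" "\<lambda>i. g (Suc i)"]) auto
  moreover have "map a [0..<Suc n] = a 0 # map (\<lambda>i. a (Suc i)) [0..<n]"
    by (simp add: upt_conv_Cons map_Suc_upt[symmetric] o_def del: upt_Suc)
  ultimately show ?case using Suc.prems[of 0] by simp
qed simp

text \<open>Since \<open>chordal\<close> quantifies over lists of arcs, a cycle found as a sequence
  of vertices has to be turned into such a list. The tails are recorded so that a chord of
  \<open>p\<close> can be read as a pair of indices of \<open>g\<close>.\<close>

lemma (in wf_digraph) cycle_through_vertices:
  assumes "0 < n" "\<And>i. i < n \<Longrightarrow> g i \<rightarrow>\<^bsub>G\<^esub> g (Suc i)" "g n = g 0" "inj_on g {..<n}"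
  obtains p where "cycle p" "length p = n" "\<And>i. i < n \<Longrightarrow> tail G (p ! i) = g i"
proof -
  have "\<forall>i. \<exists>e. i < n \<longrightarrow> e \<in> arcs G \<and> tail G e = g i \<and> head G e = g (Suc i)"
    using assms(2) by (meson reachableE)
  then obtain a where a: "\<And>i. i < n \<Longrightarrow> a i \<in> arcs G"
    "\<And>i. i < n \<Longrightarrow> tail G (a i) = g i \<and> head G (a i) = g (Suc i)"
    by metis
  define p where "p = map a [0..<n]"
  have cas: "cas (g 0) p (g 0)"
    using cas_map_upt[of n a g] a(2) assms(3) by (simp add: p_def)
  have "p \<noteq> []" using assms(1) by (simp add: p_def)
  have tl: "tl (awalk_verts (g 0) p) = map (\<lambda>i. g (Suc i)) [0..<n]"
    using a(2) \<open>p \<noteq> []\<close> by (simp add: awalk_verts_conv'[OF cas]) (simp add: p_def)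
  \<comment> \<open>\<open>cycle\<close> asks for distinctness of \<open>g 1, ..., g n\<close>, the
    assumption gives it for \<open>g 0, ..., g (n - 1)\<close>. As \<open>g n = g 0\<close>,
    reducing indices modulo \<open>n\<close> carries one to the other.\<close>
  have "inj_on (\<lambda>i. g (Suc i)) {0..<n}"
  proof (rule inj_onI)
    have g_mod: "g (Suc i) = g (Suc i mod n)" if "i < n" for i
      using that assms(3) by (cases "Suc i = n") auto
    fix i j assume ij: "i \<in> {0..<n}" "j \<in> {0..<n}" "g (Suc i) = g (Suc j)"
    then have "g (Suc i mod n) = g (Suc j mod n)" using g_mod by auto
    then have "Suc i mod n = Suc j mod n"
      using assms(1,4) by (auto dest: inj_onD)
    then show "i = j" using ij by (auto simp: mod_Suc split: if_splits)
  qed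
  then have "distinct (tl (awalk_verts (g 0) p))" by (simp add: tl distinct_map)
  moreover have "awalk (g 0) p (g 0)"
    unfolding awalk_def using cas a assms(1) by (auto simp: p_def) (metis tail_in_verts)
  ultimately have "cycle p" using \<open>p \<noteq> []\<close> by (auto simp: cycle_def)
  then show ?thesis using that[of p] a(2) by (simp add: p_def)
qed

text \<open>Close a shortest path from \<open>u\<close> to \<open>u'\<close> with interior in
  \<open>X\<close> through \<open>v\<close>. A chord between two path vertices would shorten the
  path, and a chord at \<open>v\<close> would end in \<open>X\<close>, where \<open>v\<close> has no
  neighbour.\<close>

lemma nonadjacent_neighbours_not_connected:
  assumes "graph G" "chordal G"
    and vu: "v \<rightarrow>\<^bsub>G\<^esub> u" "v \<rightarrow>\<^bsub>G\<^esub> u'" and nadj: "u \<noteq> u'" "\<not> u \<rightarrow>\<^bsub>G\<^esub> u'"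
    and X: "X \<inter> closed_nbhd G v = {}"
    and uw: "u \<rightarrow>\<^bsub>G\<^esub> w" "u' \<rightarrow>\<^bsub>G\<^esub> w'" "w \<in> X" "w' \<in> X"
    and conn: "(w, w') \<in> (arcs_ends (G \<restriction> X))\<^sup>*"
  shows False
proof -
  interpret graph G by fact
  have sym: "b \<rightarrow>\<^bsub>G\<^esub> a" if "a \<rightarrow>\<^bsub>G\<^esub> b" for a b
    using that sym_arcs by (metis arcs_ends_symmetric)
  have notv: "\<not> v \<rightarrow>\<^bsub>G\<^esub> x" if "x \<in> X" for x
    using that X adj_in_verts[of v x] by (auto simp: closed_nbhd_def nbhd_def)
  have vX: "v \<notin> X" using X by (auto simp: closed_nbhd_def)
  define P where "P a b \<longleftrightarrow> (a \<rightarrow>\<^bsub>G\<^esub> b) \<and> {a, b} \<subseteq> X \<union> {u, u'}" for a b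
  have "P\<^sup>*\<^sup>* w w'"
    using conn by induction
      (auto simp: dominates_induce_subgraph_iff P_def intro: rtranclp.rtrancl_into_rtrancl)
  moreover have "P u w" "P w' u'" using uw sym by (auto simp: P_def)
  ultimately have "P\<^sup>*\<^sup>* u u'"
    by (meson converse_rtranclp_into_rtranclp rtranclp.rtrancl_into_rtrancl)
  then obtain n0 where n0: "(P ^^ n0) u u'" by (auto dest: rtranclp_imp_relpowp)
  define n where "n = (LEAST n. (P ^^ n) u u')"
  have n: "(P ^^ n) u u'" unfolding n_def using n0 by (rule LeastI)
  have minimal: "n \<le> m" if "(P ^^ m) u u'" for m
    unfolding n_def using that by (rule Least_le)
  obtain f where f: "f 0 = u" "f n = u'" "\<And>i. i < n \<Longrightarrow> P (f i) (f (Suc i))"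
    using n by (auto simp: relpowp_fun_conv)
  have prefix: "(P ^^ i) u (f i)" if "i \<le> n" for i
    using that f by (auto simp: relpowp_fun_conv)
  have suffix: "(P ^^ (n - j)) (f j) u'" if "j \<le> n" for j
    unfolding relpowp_fun_conv using that f by (intro exI[of _ "\<lambda>i. f (i + j)"]) auto
  have inj: "f i \<noteq> f j" if "i < j" "j \<le> n" for i j
  proof
    assume "f i = f j"
    then have "(P ^^ (i + (n - j))) u u'"
      using prefix[of i] suffix[of j] that by (subst relpowp_add) auto
    from minimal[OF this] that show False by simp
  qed
  have mem: "f i \<in> X \<union> {u, u'}" if "i \<le> n" for i
  proof (cases "i = n")
    case False
    then show ?thesis using f(3)[of i] that by (auto simp: P_def)
  qed (use f in simp)
  have interior: "f i \<in> X" if "0 < i" "i < n" for i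
    using mem[of i] inj[of 0 i] inj[of i n] that f by auto
  have no_chord: "j = Suc i" if "i < j" "j \<le> n" "f i \<rightarrow>\<^bsub>G\<^esub> f j" for i j
  proof -
    have "P (f i) (f j)" using mem[of i] mem[of j] that by (simp add: P_def)
    then have "(P ^^ Suc i) u (f j)" using prefix[of i] that by auto
    then have "(P ^^ (Suc i + (n - j))) u u'"
      using suffix[of j] that by (subst relpowp_add) blast
    from minimal[OF this] that show ?thesis by simp
  qed
  \<comment> \<open>With \<open>v\<close> added, the cycle has \<open>n + 2\<close> vertices, hence
    at least 4, as \<open>chordal\<close> requires.\<close>
  have n_ge: "2 \<le> n"
  proof (rule ccontr)
    assume "\<not> 2 \<le> n"
    then have "n = 0 \<or> n = 1" by auto
    then show False using f nadj by (auto simp: P_def)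
  qed
  have v_notin: "f i \<noteq> v" if "i \<le> n" for i
    using mem[OF that] vX vu adj_not_same by auto
  \<comment> \<open>\<open>v\<close> sits at both ends and the path is shifted by one, so the
    neighbours of \<open>v\<close> along the cycle have the indices \<open>1\<close> and
    \<open>n + 1\<close>. A chord from index \<open>0\<close> therefore ends at an interior vertex
    of the path.\<close>
  define g where "g i = (if i = 0 \<or> i = n + 2 then v else f (i - 1))" for i
  have "g i \<rightarrow>\<^bsub>G\<^esub> g (Suc i)" if i: "i < n + 2" for i
  proof -
    consider "i = 0" | "i = n + 1" | "0 < i" "i \<le> n" using i by linarith
    then show ?thesis
    proof cases
      case 3
      then have "P (f (i - 1)) (f (Suc (i - 1)))" by (intro f(3)) simp
      with 3 show ?thesis by (simp add: g_def P_def)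
    qed (use f vu sym in \<open>auto simp: g_def\<close>)
  qed
  moreover have "inj_on g {..<n + 2}"
  proof (rule linorder_inj_onI)
    fix i j assume ij: "i < j" "i \<in> {..<n + 2}" "j \<in> {..<n + 2}"
    show "g i \<noteq> g j"
    proof (cases "i = 0")
      case True
      moreover have "f (j - 1) \<noteq> v" using ij by (intro v_notin) auto
      ultimately show ?thesis using ij by (auto simp: g_def)
    next
      case False
      then show ?thesis using inj[of "i - 1" "j - 1"] ij by (auto simp: g_def)
    qed
  qed auto
  ultimately obtain p where p: "cycle p" "length p = n + 2" "\<And>i. i < n + 2 \<Longrightarrow> tail G (p ! i) = g i"
    using cycle_through_vertices[of "n + 2" g] by (auto simp: g_def)
  then obtain i j where ij: "i < j" "j < n + 2" "j \<noteq> i + 1" "\<not> (i = 0 \<and> j = n + 1)" "g i \<rightarrow>\<^bsub>G\<^esub> g j"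
    using \<open>chordal G\<close> n_ge unfolding chordal_def by force
  show False
  proof (cases "i = 0")
    case True
    then show False using ij interior[of "j - 1"] notv by (auto simp: g_def)
  next
    case False
    then have "f (i - 1) \<rightarrow>\<^bsub>G\<^esub> f (j - 1)" using ij by (simp add: g_def)
    then have "j - 1 = Suc (i - 1)" using ij False by (intro no_chord) linarith+
    then show False using ij False by linarith
  qed
qed

section \<open>The greedy algorithm: one step and the whole run\<close>

lemma min_vdegree_le:
  assumes "finite (verts G)" "u \<in> verts G"
  shows "min_vdegree G \<le> vdegree G u"
  unfolding min_vdegree_def using assms by (intro Min_le) auto

text \<open>Neither \<open>u\<close> nor \<open>u'\<close> is a neighbour of \<open>u\<close>. If
  all neighbours of \<open>u\<close> were in \<open>N[v]\<close>, they would lie in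
  \<open>N(v)\<close> with these two removed and \<open>v\<close> added, so \<open>u\<close> would
  have smaller degree than \<open>v\<close>.\<close>

lemma min_degree_private_neighbour:
  assumes "graph G" "vdegree G v = min_vdegree G"
    and "v \<rightarrow>\<^bsub>G\<^esub> u" "v \<rightarrow>\<^bsub>G\<^esub> u'" "u \<noteq> u'" "\<not> u \<rightarrow>\<^bsub>G\<^esub> u'"
  obtains w where "u \<rightarrow>\<^bsub>G\<^esub> w" "w \<in> verts G - closed_nbhd G v"
proof -
  interpret graph G by fact
  have fin: "finite (nbhd G x)" for x by (simp add: nbhd_def)
  have verts: "u \<in> verts G" "u' \<in> verts G" "v \<in> verts G"
    using assms(3,4) adj_in_verts by blast+
  have "\<not> nbhd G u \<subseteq> closed_nbhd G v"
  proof
    assume "nbhd G u \<subseteq> closed_nbhd G v"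
    then have "nbhd G u \<subseteq> insert v (nbhd G v - {u, u'})"
      using assms(6) adj_not_same by (auto simp: nbhd_def closed_nbhd_def)
    then have "card (nbhd G u) \<le> card (insert v (nbhd G v - {u, u'}))"
      by (intro card_mono) (auto simp: fin)
    also have "\<dots> \<le> Suc (card (nbhd G v - {u, u'}))" by (rule card_insert_le_m1) auto
    also have "\<dots> < card (nbhd G v)"
    proof -
      have sub: "{u, u'} \<subseteq> nbhd G v" using assms verts by (auto simp: nbhd_def)
      then have "2 \<le> card (nbhd G v)" using card_mono[OF fin sub] assms(5) by simp
      then show ?thesis using card_Diff_subset[OF _ sub] assms(5) by simp
    qed
    finally show False
      using min_vdegree_le[of G u] verts assms(2) by (simp add: vdegree_def)
  qed
  then show ?thesis using that by (auto simp: nbhd_def)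
qed

text \<open>The potential \<open>card I + card A\<close> drops by at most 2 when one vertex is
  chosen. If at most one vertex of \<open>I\<close> is lost, discarding the representative of the
  component of \<open>v\<close> is affordable. Otherwise each lost vertex is replaced by a new
  representative.\<close>

lemma greedy_step_potential:
  assumes "graph G" "chordal G" "v \<in> verts G" "vdegree G v = min_vdegree G"
    and "indep_set G I" "separated G A"
  obtains I' A' where
    "indep_set (G \<restriction> (verts G - closed_nbhd G v)) I'"
    "separated (G \<restriction> (verts G - closed_nbhd G v)) A'"
    "card I + card A \<le> card I' + card A' + 2"
proof -
  interpret graph G by fact
  define X where "X = verts G - closed_nbhd G v"
  define E' where "E' = (arcs_ends (G \<restriction> X))\<^sup>*"
  have sym: "b \<rightarrow>\<^bsub>G\<^esub> a" if "a \<rightarrow>\<^bsub>G\<^esub> b" for a b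
    using that sym_arcs by (metis arcs_ends_symmetric)
  have sym_rtrancl: "(b, a) \<in> (arcs_ends G)\<^sup>*" if "(a, b) \<in> (arcs_ends G)\<^sup>*" for a b
    using that sym by (meson symE symI sym_rtrancl)
  have E'_sub: "E' \<subseteq> (arcs_ends G)\<^sup>*"
    unfolding E'_def by (rule rtrancl_mono) (auto simp: dominates_induce_subgraph_iff)
  have I: "I \<subseteq> verts G" "finite I" "\<And>a b. a \<in> I \<Longrightarrow> b \<in> I \<Longrightarrow> \<not> a \<rightarrow>\<^bsub>G\<^esub> b"
    using assms(5) finite_subset[OF _ finite_verts] by (auto simp: indep_set_def)
  have A: "A \<subseteq> verts G" "finite A" "\<And>a b. a \<in> A \<Longrightarrow> b \<in> A \<Longrightarrow> (a, b) \<in> (arcs_ends G)\<^sup>* \<Longrightarrow> a = b"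
    using assms(6) finite_subset[OF _ finite_verts] by (auto simp: separated_def)
  define I' where "I' = I \<inter> X"
  define K where "K = I - X"
  have indep': "indep_set (G \<restriction> X) I'"
    using I by (auto simp: indep_set_def I'_def dominates_induce_subgraph_iff)
  have cardI: "card I = card I' + card K"
    unfolding I'_def K_def using I(2) by (rule card_Int_Diff)
  \<comment> \<open>These representatives lie outside the component of \<open>v\<close>, hence
    survive in \<open>X\<close>; separatedness of \<open>A\<close> means that at most one is
    discarded.\<close>
  define A0 where "A0 = {a \<in> A. (v, a) \<notin> (arcs_ends G)\<^sup>*}"
  have "card (A - A0) \<le> 1"
  proof (intro card_le_Suc0_iff_eq[THEN iffD2, simplified One_nat_def[symmetric]] ballI)
    fix a b assume "a \<in> A - A0" "b \<in> A - A0"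
    then show "a = b"
      using A(3)[of a b] sym_rtrancl by (auto simp: A0_def intro: rtrancl_trans)
  qed (use A in auto)
  moreover have "card A = card A0 + card (A - A0)"
    using A(2) by (subst card_Int_Diff[of _ A0]) (auto simp: A0_def Int_def intro: arg_cong[of _ _ card])
  ultimately have cardA: "card A \<le> card A0 + 1" by simp
  have A0: "A0 \<subseteq> X" "finite A0"
    using A by (auto simp: A0_def X_def closed_nbhd_def nbhd_def)
  have sepA0: "a = b" if "a \<in> A0" "b \<in> A0" "(a, b) \<in> E'" for a b
    using that A E'_sub by (auto simp: A0_def)
  show ?thesis
  proof (cases "card K \<le> 1")
    case True
    have "separated (G \<restriction> X) A0"
      using A0 sepA0 by (auto simp: separated_def E'_def)
    then show ?thesis using that[of I' A0] indep' cardI cardA True by (simp add: X_def)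
  next
    case False
    have K_sub: "K \<subseteq> closed_nbhd G v" "K \<subseteq> I" using I by (auto simp: K_def X_def)
    \<comment> \<open>If \<open>v\<close> were in \<open>I\<close>, independence would leave no
      other vertex of \<open>I\<close> in \<open>N[v]\<close>, against
      \<open>card K > 1\<close>.\<close>
    have "v \<notin> K"
    proof
      assume "v \<in> K"
      then have "K \<subseteq> {v}" using K_sub I(3) unfolding closed_nbhd_def nbhd_def by blast
      then show False using False card_mono[of "{v}" K] by simp
    qed
    then have adjK: "v \<rightarrow>\<^bsub>G\<^esub> u" if "u \<in> K" for u
      using that K_sub by (auto simp: closed_nbhd_def nbhd_def)
    have "\<exists>w. (u \<rightarrow>\<^bsub>G\<^esub> w) \<and> w \<in> X" if u: "u \<in> K" for u
    proof -
      have "\<not> K \<subseteq> {u}" using False card_mono[of "{u}" K] by auto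
      then obtain u' where "u' \<in> K" "u' \<noteq> u" by auto
      then show ?thesis
        using min_degree_private_neighbour[OF assms(1,4), of u u'] adjK u K_sub I(3)
        unfolding X_def by (metis subsetD)
    qed
    then obtain w where w: "\<And>u. u \<in> K \<Longrightarrow> u \<rightarrow>\<^bsub>G\<^esub> w u" "\<And>u. u \<in> K \<Longrightarrow> w u \<in> X" by metis
    have sepK: "u = u'" if "u \<in> K" "u' \<in> K" "(w u, w u') \<in> E'" for u u'
    proof (rule ccontr)
      assume "u \<noteq> u'"
      moreover have "\<not> u \<rightarrow>\<^bsub>G\<^esub> u'" using that K_sub I(3) by blast
      moreover have "X \<inter> closed_nbhd G v = {}" by (auto simp: X_def)
      ultimately show False
        using nonadjacent_neighbours_not_connected[OF assms(1,2), of v u u' X "w u" "w u'"]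
          adjK w that by (auto simp: E'_def)
    qed
    have reach: "(v, w u) \<in> (arcs_ends G)\<^sup>*" if "u \<in> K" for u
      using adjK[OF that] w(1)[OF that] by (meson r_into_rtrancl rtrancl_into_rtrancl)
    have inj: "inj_on w K"
      by (rule inj_onI) (use sepK in \<open>auto simp: E'_def\<close>)
    have disj: "A0 \<inter> w ` K = {}" using reach by (auto simp: A0_def)
    \<comment> \<open>In \<open>G\<close>, \<open>w u\<close> is in the component of
      \<open>v\<close> and \<open>a\<close> is not; deleting vertices cannot connect them.\<close>
    have cross: "(a, w u) \<notin> E'" "(w u, a) \<notin> E'" if "a \<in> A0" "u \<in> K" for a u
      using that reach[of u] E'_sub sym_rtrancl unfolding A0_def
      by (blast intro: rtrancl_trans)+
    have "separated (G \<restriction> X) (A0 \<union> w ` K)"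
      unfolding separated_def E'_def[symmetric]
    proof (intro conjI ballI impI)
      show "A0 \<union> w ` K \<subseteq> verts (G \<restriction> X)" using A0 w(2) by auto
      fix a b assume "a \<in> A0 \<union> w ` K" "b \<in> A0 \<union> w ` K" "(a, b) \<in> E'"
      then show "a = b" using sepA0 sepK cross by blast
    qed
    moreover have "card (A0 \<union> w ` K) = card A0 + card K"
      using A0 I(2) disj inj by (subst card_Un_disjoint) (auto simp: K_def card_image)
    ultimately show ?thesis
      using that[of I' "A0 \<union> w ` K"] indep' cardI cardA by (simp add: X_def)
  qed
qed

text \<open>The run may start with any chosen set \<open>T\<close>, and \<open>I\<close> and
  \<open>A\<close> are arbitrary because each step replaces them. The drop of at most 2 is balanced
  by \<open>2 * card T\<close>, which grows by exactly 2 since \<open>T\<close> avoids the current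
  vertices.\<close>

lemma greedy_run_bound:
  assumes "greedy_step\<^sup>*\<^sup>* (G, T) (H, S)" "verts H = {}"
    and "graph G" "chordal G" "indep_set G I" "separated G A"
    and "finite T" "T \<inter> verts G = {}"
  shows "card I + card A + 2 * card T \<le> 2 * card S"
  using assms
proof (induction arbitrary: I A rule: converse_rtranclp_induct2)
  case refl
  then show ?case by (auto simp: indep_set_def separated_def)
next
  case (step G T G' T')
  from step.hyps(1) obtain v where v: "v \<in> verts G" "vdegree G v = min_vdegree G"
    "G' = G \<restriction> (verts G - closed_nbhd G v)" "T' = insert v T"
    by (cases rule: greedy_step.cases) auto
  obtain I' A' where IA: "indep_set G' I'" "separated G' A'"
    "card I + card A \<le> card I' + card A' + 2"
    using greedy_step_potential[OF step.prems(2,3) v(1,2) step.prems(4,5)] v(3) by metis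
  have "graph G'" using step.prems v by (auto intro: graph_induce_subgraph)
  moreover have "chordal G'"
  proof -
    interpret graph G by fact
    show ?thesis
      unfolding v(3) using step.prems wf_digraph by (intro chordal_induce_subgraph) auto
  qed
  moreover have "T' \<inter> verts G' = {}" "finite T'"
    using step.prems v by (auto simp: closed_nbhd_def)
  ultimately have "card I' + card A' + 2 * card T' \<le> 2 * card S"
    using step.IH[OF step.prems(1)] IA by blast
  moreover have "card T' = Suc (card T)"
    unfolding v(4) using step.prems v(1) by (intro card_insert_disjoint) auto
  ultimately show ?case using IA(3) by simp
qed

theorem theorem1:
  fixes G :: "('a, 'b) pre_digraph" and I S :: "'a set"
  assumes "graph G"
    and "chordal G"
    and "max_indep_set G I"
    and "greedy_output G S"
  shows "real (card S) \<ge> 1 / 2 * real (card I)"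
proof -
  obtain H where "greedy_step\<^sup>*\<^sup>* (G, {}) (H, S)" "verts H = {}"
    using assms(4) by (auto simp: greedy_output_def)
  moreover have "indep_set G I" using assms(3) by (simp add: max_indep_set_def)
  \<comment> \<open>The run starts with the separated set \<open>{}\<close>; representatives are
    collected along the way.\<close>
  ultimately have "card I + card ({} :: 'a set) + 2 * card ({} :: 'a set) \<le> 2 * card S"
    using assms(1,2) by (intro greedy_run_bound) (auto simp: separated_def)
  then show ?thesis by simp
qed

end
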